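(* Let $R$ and $R'$ be semirings and let $\phi\colon R\to R'$ be a semiring homomorphism. For $k$-ideals $I, I_1, I_2$ of $R$ and $k$-ideals $J, J_1, J_2$ of $R'$, the following hold. (1) $J^c$ is a $k$-ideal of $R$. (2) The kernel $\ker\phi=\{r\in R\mid \phi(r)=0\}$ is a $k$-ideal of $R$. (3) $I^e$ is a $k$-ideal of $R'$. (4) (a) $I\subseteq I^{ec}$; (b) $J\supseteq J^{ce}$; (c) $J^c=J^{cec}$; (d) $I^e=I^{ece}$. (5) There is a bijection between the set of $k$-ideals $I$ of $R$ with $I^{ec}=I$ and the set of $k$-ideals $J$ of $R'$ with $J^{ce}=J$. (6) (a) $(I_1\cap I_2)^e\subseteq I_1^e\cap I_2^e$; (b) $(I_1I_2)^e=I_1^eI_2^e$; (c) $(I_1:I_2)^e\subseteq (I_1^e:I_2^e)$; (d) $(\mathcal{R}_k(I))^e\subseteq \mathcal{R}_k(I^e)$. (7) (a) $(J_1\cap J_2)^c=J_1^c\cap J_2^c$; (b) $(J_1J_2)^c\supseteq J_1^cJ_2^c$; (c) $(J_1:J_2)^c\subseteq (J_1^c:J_2^c)$; (d) $(\mathcal{R}_k(J))^c=\mathcal{R}_k(J^c)$. (8) $(\mathcal{R}_k(J))^c\subseteq \mathcal{R}_k(J^c)$.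
   Context: A semiring means a commutative semiring with $0$ and $1$: $(R,+,0)$ and $(R,\cdot,1)$ are commutative monoids, $0\cdot x=0$ for all $x$, and $\cdot$ distributes over $+$. A semiring homomorphism preserves $+$, $\cdot$, $0$ and $1$. An ideal of $R$ is an additive submonoid $I$ with $rx\in I$ for all $r\in R$, $x\in I$; $\langle S\rangle$ is the ideal generated by $S$. A $k$-ideal is an ideal $I$ such that $x, x+y\in I$ implies $y\in I$; a $k$-proper ideal is a $k$-ideal $I\ne R$. The $k$-closure of an ideal $I$ is $\mathcal{C}_k(I)=\{r\in R\mid r+x\in I \text{ for some } x\in I\}$. The product of two $k$-ideals $I,J$ is $IJ=\mathcal{C}_k(\langle\{xy\mid x\in I,y\in J\}\rangle)$. The ideal quotient is $(I:J)=\{r\in R\mid rJ\subseteq I\}$. A $k$-proper ideal $P$ is $k$-prime if for all $k$-ideals $I,J$ of $R$, $IJ\subseteq P$ implies $I\subseteq P$ or $J\subseteq P$. The $k$-radical $\mathcal{R}_k(I)$ of a $k$-ideal $I$ is the intersection of all $k$-prime ideals containing $I$ (the whole semiring if there are none). The same definitions apply in $R'$. For a homomorphism $\phi\colon R\to R'$: the $k$-contraction of a $k$-ideal $J$ of $R'$ is $J^c=\phi^{-1}(J)$; the $k$-extension of a $k$-ideal $I$ of $R$ is $I^e=\mathcal{C}_k(\langle\phi(I)\rangle)$. Iterated superscripts are applied from left to right, e.g. $I^{ec}=(I^e)^c$. *)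

theory Defs
  imports "HOL-Algebra.Ring"
begin

locale comm_semiring_struct = semiring R + comm_monoid R for R (structure)

text \<open>The zero must be mentioned explicitly, since \<^const>\<open>ring_hom\<close> preserves it
  automatically only between rings.\<close>

definition semiring_hom ::
    "('a, 'm) ring_scheme \<Rightarrow> ('b, 'n) ring_scheme \<Rightarrow> ('a \<Rightarrow> 'b) set"
  where "semiring_hom R S = {h \<in> ring_hom R S. h \<zero>\<^bsub>R\<^esub> = \<zero>\<^bsub>S\<^esub>}"

definition semiring_ideal :: "'a set \<Rightarrow> ('a, 'm) ring_scheme \<Rightarrow> bool"
  where "semiring_ideal I R \<longleftrightarrow>
    submonoid I (add_monoid R) \<and> (\<forall>r\<in>carrier R. \<forall>x\<in>I. r \<otimes>\<^bsub>R\<^esub> x \<in> I)"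

definition gen_ideal :: "('a, 'm) ring_scheme \<Rightarrow> 'a set \<Rightarrow> 'a set"
  where "gen_ideal R X = \<Inter>{I. semiring_ideal I R \<and> X \<subseteq> I}"

definition k_ideal :: "'a set \<Rightarrow> ('a, 'm) ring_scheme \<Rightarrow> bool"
  where "k_ideal I R \<longleftrightarrow> semiring_ideal I R \<and>
    (\<forall>x\<in>carrier R. \<forall>y\<in>carrier R. x \<in> I \<and> x \<oplus>\<^bsub>R\<^esub> y \<in> I \<longrightarrow> y \<in> I)"

definition k_proper_ideal :: "'a set \<Rightarrow> ('a, 'm) ring_scheme \<Rightarrow> bool"
  where "k_proper_ideal I R \<longleftrightarrow> k_ideal I R \<and> I \<noteq> carrier R"

definition k_closure :: "('a, 'm) ring_scheme \<Rightarrow> 'a set \<Rightarrow> 'a set"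
  where "k_closure R I = {r \<in> carrier R. \<exists>x\<in>I. r \<oplus>\<^bsub>R\<^esub> x \<in> I}"

definition k_product :: "('a, 'm) ring_scheme \<Rightarrow> 'a set \<Rightarrow> 'a set \<Rightarrow> 'a set"
  where "k_product R I J = k_closure R (gen_ideal R {x \<otimes>\<^bsub>R\<^esub> y |x y. x \<in> I \<and> y \<in> J})"

definition ideal_quotient :: "('a, 'm) ring_scheme \<Rightarrow> 'a set \<Rightarrow> 'a set \<Rightarrow> 'a set"
  where "ideal_quotient R I J = {r \<in> carrier R. \<forall>x\<in>J. r \<otimes>\<^bsub>R\<^esub> x \<in> I}"

definition k_prime_ideal :: "'a set \<Rightarrow> ('a, 'm) ring_scheme \<Rightarrow> bool"
  where "k_prime_ideal P R \<longleftrightarrow> k_proper_ideal P R \<and>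
    (\<forall>I J. k_ideal I R \<and> k_ideal J R \<and> k_product R I J \<subseteq> P \<longrightarrow> I \<subseteq> P \<or> J \<subseteq> P)"

text \<open>Intersecting with the carrier matters only when no k-prime ideal contains \<open>I\<close>;
  the radical is then the whole semiring.\<close>

definition k_radical :: "('a, 'm) ring_scheme \<Rightarrow> 'a set \<Rightarrow> 'a set"
  where "k_radical R I = carrier R \<inter> \<Inter>{P. k_prime_ideal P R \<and> I \<subseteq> P}"

definition k_contraction :: "('a, 'm) ring_scheme \<Rightarrow> ('a \<Rightarrow> 'b) \<Rightarrow> 'b set \<Rightarrow> 'a set"
  where "k_contraction R \<phi> J = {r \<in> carrier R. \<phi> r \<in> J}"

definition k_extension :: "('b, 'n) ring_scheme \<Rightarrow> ('a \<Rightarrow> 'b) \<Rightarrow> 'a set \<Rightarrow> 'b set"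
  where "k_extension R' \<phi> I = k_closure R' (gen_ideal R' (\<phi> ` I))"

end

theory Submission
  imports Defs
begin

text \<open>The operation \<open>k_closure R (gen_ideal R X)\<close> produces the least k-ideal containing \<open>X\<close>, and
  quotients of k-ideals are k-ideals; so membership statements about extensions and products need
  only be checked on generators. For the radical, a k-ideal is k-prime iff it is proper and prime
  elementwise. Hence \<open>k_radical R I\<close> consists of the elements having a power in \<open>I\<close>: a k-ideal \<open>P\<close>
  maximal among those containing \<open>I\<close> and no power of \<open>x\<close> is prime, because if \<open>a \<otimes> b \<in> P\<close> with
  \<open>a, b \<notin> P\<close>, then \<open>(P : b)\<close> strictly contains \<open>P\<close> and so contains some \<open>x [^] n\<close>; then
  \<open>(P : x [^] n)\<close> contains \<open>b\<close>, hence some \<open>x [^] m\<close>, and \<open>x [^] (n + m) \<in> P\<close>.\<close>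

section \<open>k-ideals as closure conditions, and the ideals they are generated from\<close>

abbreviation k_span :: "('a, 'm) ring_scheme \<Rightarrow> 'a set \<Rightarrow> 'a set"
  where "k_span R X \<equiv> k_closure R (gen_ideal R X)"

lemma semiring_ideal_iff:
  "semiring_ideal I R \<longleftrightarrow> I \<subseteq> carrier R \<and> \<zero>\<^bsub>R\<^esub> \<in> I \<and>
    (\<forall>x\<in>I. \<forall>y\<in>I. x \<oplus>\<^bsub>R\<^esub> y \<in> I) \<and> (\<forall>r\<in>carrier R. \<forall>x\<in>I. r \<otimes>\<^bsub>R\<^esub> x \<in> I)"
  unfolding semiring_ideal_def submonoid_def by auto

lemma k_ideal_iff:
  "k_ideal I R \<longleftrightarrow> I \<subseteq> carrier R \<and> \<zero>\<^bsub>R\<^esub> \<in> I \<and>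
    (\<forall>x\<in>I. \<forall>y\<in>I. x \<oplus>\<^bsub>R\<^esub> y \<in> I) \<and> (\<forall>r\<in>carrier R. \<forall>x\<in>I. r \<otimes>\<^bsub>R\<^esub> x \<in> I) \<and>
    (\<forall>x\<in>I. \<forall>y\<in>carrier R. x \<oplus>\<^bsub>R\<^esub> y \<in> I \<longrightarrow> y \<in> I)"
  unfolding k_ideal_def semiring_ideal_iff by blast

lemma k_ideal_subset: "k_ideal I R \<Longrightarrow> I \<subseteq> carrier R"
  and k_ideal_zero: "k_ideal I R \<Longrightarrow> \<zero>\<^bsub>R\<^esub> \<in> I"
  and k_ideal_add: "k_ideal I R \<Longrightarrow> x \<in> I \<Longrightarrow> y \<in> I \<Longrightarrow> x \<oplus>\<^bsub>R\<^esub> y \<in> I"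
  and k_ideal_mult: "k_ideal I R \<Longrightarrow> r \<in> carrier R \<Longrightarrow> x \<in> I \<Longrightarrow> r \<otimes>\<^bsub>R\<^esub> x \<in> I"
  and k_ideal_cancel: "k_ideal I R \<Longrightarrow> x \<in> I \<Longrightarrow> y \<in> carrier R \<Longrightarrow> x \<oplus>\<^bsub>R\<^esub> y \<in> I \<Longrightarrow> y \<in> I"
  unfolding k_ideal_iff by blast+

lemma gen_ideal_superset: "X \<subseteq> gen_ideal R X"
  unfolding gen_ideal_def by blast

lemma gen_ideal_least: "semiring_ideal I R \<Longrightarrow> X \<subseteq> I \<Longrightarrow> gen_ideal R X \<subseteq> I"
  unfolding gen_ideal_def by blast

text \<open>Each closure condition involves at most two elements of the union, and in a chain two
  such elements lie in a common member, where the condition is known. This supplies the upper bounds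
  for Zorn's lemma.\<close>

lemma k_ideal_Union_chain:
  assumes "C \<noteq> {}" and ideals: "\<And>I. I \<in> C \<Longrightarrow> k_ideal I R"
    and chain: "\<And>I J. I \<in> C \<Longrightarrow> J \<in> C \<Longrightarrow> I \<subseteq> J \<or> J \<subseteq> I"
  shows "k_ideal (\<Union>C) R"
proof -
  have common: "\<exists>K\<in>C. x \<in> K \<and> y \<in> K" if "x \<in> \<Union>C" "y \<in> \<Union>C" for x y
    using that chain by blast
  have "\<Union>C \<subseteq> carrier R"
    using k_ideal_subset[OF ideals] by blast
  moreover have "\<zero>\<^bsub>R\<^esub> \<in> \<Union>C"
    using assms(1) k_ideal_zero[OF ideals] by blast
  moreover have "x \<oplus>\<^bsub>R\<^esub> y \<in> \<Union>C" if "x \<in> \<Union>C" "y \<in> \<Union>C" for x y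
  proof -
    obtain K where "K \<in> C" "x \<in> K" "y \<in> K"
      using common[OF \<open>x \<in> \<Union>C\<close> \<open>y \<in> \<Union>C\<close>] by blast
    then have "x \<oplus>\<^bsub>R\<^esub> y \<in> K"
      using k_ideal_add[OF ideals] by blast
    then show ?thesis
      using \<open>K \<in> C\<close> by blast
  qed
  moreover have "r \<otimes>\<^bsub>R\<^esub> x \<in> \<Union>C" if "r \<in> carrier R" "x \<in> \<Union>C" for r x
    using that k_ideal_mult[OF ideals] by blast
  moreover have "y \<in> \<Union>C" if "x \<in> \<Union>C" "y \<in> carrier R" "x \<oplus>\<^bsub>R\<^esub> y \<in> \<Union>C" for x y
  proof -
    obtain K where "K \<in> C" "x \<in> K" "x \<oplus>\<^bsub>R\<^esub> y \<in> K"
      using common[OF \<open>x \<in> \<Union>C\<close> \<open>x \<oplus>\<^bsub>R\<^esub> y \<in> \<Union>C\<close>] by blast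
    then have "y \<in> K"
      using k_ideal_cancel[OF ideals] \<open>y \<in> carrier R\<close> by blast
    then show ?thesis
      using \<open>K \<in> C\<close> by blast
  qed
  ultimately show ?thesis
    unfolding k_ideal_iff by blast
qed

section \<open>k-closure and the least k-ideal containing a set\<close>

context comm_semiring_struct
begin

text \<open>The carrier is one of the ideals being intersected, which keeps the intersection inside
  it; the closure conditions pass to intersections.\<close>

lemma semiring_ideal_gen_ideal:
  assumes "X \<subseteq> carrier R"
  shows "semiring_ideal (gen_ideal R X) R"
proof -
  have "semiring_ideal (carrier R) R"
    unfolding semiring_ideal_iff by simp
  then have "gen_ideal R X \<subseteq> carrier R"
    using assms by (rule gen_ideal_least)
  then show ?thesis
    unfolding semiring_ideal_iff gen_ideal_def by blast
qed

text \<open>Witnesses combine: \<open>a \<oplus> b\<close> serves for a sum and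
  \<open>r \<otimes> a\<close> for a multiple. For cancellation, if \<open>a\<close> serves for
  \<open>x\<close> and \<open>c\<close> for \<open>x \<oplus> y\<close>, then
  \<open>(x \<oplus> a) \<oplus> c\<close> serves for \<open>y\<close>.\<close>

lemma k_ideal_k_closure:
  assumes "semiring_ideal I R"
  shows "k_ideal (k_closure R I) R"
proof -
  have sub: "\<And>x. x \<in> I \<Longrightarrow> x \<in> carrier R" and zero: "\<zero> \<in> I"
    and add: "\<And>x y. x \<in> I \<Longrightarrow> y \<in> I \<Longrightarrow> x \<oplus> y \<in> I"
    and mult: "\<And>r x. r \<in> carrier R \<Longrightarrow> x \<in> I \<Longrightarrow> r \<otimes> x \<in> I"
    using assms unfolding semiring_ideal_iff by blast+
  have "x \<oplus> y \<in> k_closure R I" if xy: "x \<in> k_closure R I" "y \<in> k_closure R I" for x y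
  proof -
    obtain a b where ab: "x \<in> carrier R" "y \<in> carrier R" "a \<in> I" "b \<in> I" "x \<oplus> a \<in> I" "y \<oplus> b \<in> I"
      using xy unfolding k_closure_def by blast
    moreover have "(x \<oplus> y) \<oplus> (a \<oplus> b) = (x \<oplus> a) \<oplus> (y \<oplus> b)"
      using ab sub by (simp add: a_ac)
    ultimately show ?thesis
      unfolding k_closure_def using add by (metis (mono_tags, lifting) a_closed mem_Collect_eq)
  qed
  moreover have "r \<otimes> x \<in> k_closure R I" if r: "r \<in> carrier R" and x: "x \<in> k_closure R I" for r x
  proof -
    obtain a where a: "x \<in> carrier R" "a \<in> I" "x \<oplus> a \<in> I"
      using x unfolding k_closure_def by blast
    then have "r \<otimes> x \<oplus> r \<otimes> a \<in> I"
      using r sub mult by (metis r_distr)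
    then show ?thesis
      unfolding k_closure_def using r a mult by blast
  qed
  moreover have "y \<in> k_closure R I"
    if x: "x \<in> k_closure R I" and y: "y \<in> carrier R" and xy: "x \<oplus> y \<in> k_closure R I" for x y
  proof -
    obtain a c where ac: "x \<in> carrier R" "a \<in> I" "x \<oplus> a \<in> I" "c \<in> I" "(x \<oplus> y) \<oplus> c \<in> I"
      using x xy unfolding k_closure_def by blast
    moreover have "y \<oplus> ((x \<oplus> a) \<oplus> c) = ((x \<oplus> y) \<oplus> c) \<oplus> a"
      using ac sub y by (simp add: a_ac)
    ultimately have "(x \<oplus> a) \<oplus> c \<in> I" "y \<oplus> ((x \<oplus> a) \<oplus> c) \<in> I"
      using add by auto
    then show ?thesis
      unfolding k_closure_def using y by blast
  qed
  moreover have "k_closure R I \<subseteq> carrier R" "\<zero> \<in> k_closure R I"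
    unfolding k_closure_def using zero by (auto intro!: bexI[of _ \<zero>])
  ultimately show ?thesis
    unfolding k_ideal_iff by blast
qed

lemma k_ideal_k_span: "X \<subseteq> carrier R \<Longrightarrow> k_ideal (k_span R X) R"
  by (intro k_ideal_k_closure semiring_ideal_gen_ideal)

lemma k_span_superset:
  assumes "X \<subseteq> carrier R"
  shows "X \<subseteq> k_span R X"
proof
  fix x assume "x \<in> X"
  then have "x \<in> gen_ideal R X" "x \<in> carrier R" "\<zero> \<in> gen_ideal R X"
    using gen_ideal_superset[of X R] assms semiring_ideal_gen_ideal[OF assms]
    unfolding semiring_ideal_iff by auto
  then show "x \<in> k_span R X"
    \<comment> \<open>The witness for membership in the closure is \<open>\<zero>\<close>.\<close>
    unfolding k_closure_def by force
qed

text \<open>Cancellation in \<open>K\<close> undoes the closure: \<open>r \<oplus> x\<close> and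
  \<open>x\<close> in \<open>K\<close> force \<open>r\<close> into \<open>K\<close>.\<close>

lemma k_span_least:
  assumes K: "k_ideal K R" and "X \<subseteq> K"
  shows "k_span R X \<subseteq> K"
proof
  fix r assume "r \<in> k_span R X"
  moreover have "gen_ideal R X \<subseteq> K"
    using assms by (intro gen_ideal_least) (auto simp: k_ideal_def)
  ultimately obtain x where x: "r \<in> carrier R" "x \<in> K" "r \<oplus> x \<in> K"
    unfolding k_closure_def by blast
  then have "x \<oplus> r \<in> K"
    using k_ideal_subset[OF K] by (metis a_comm subsetD)
  then show "r \<in> K"
    using k_ideal_cancel[OF K] x by blast
qed

section \<open>Ideal quotients and products\<close>

lemma k_ideal_mult_right: "k_ideal I R \<Longrightarrow> x \<in> I \<Longrightarrow> r \<in> carrier R \<Longrightarrow> x \<otimes> r \<in> I"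
  by (metis k_ideal_mult k_ideal_subset m_comm subsetD)

text \<open>Multiplication by a fixed \<open>b\<close> is additive, so each closure condition is
  inherited from \<open>K\<close>. Taking an arbitrary subset for \<open>B\<close> admits singletons
  and generating sets as well as ideals.\<close>

lemma k_ideal_ideal_quotient:
  assumes K: "k_ideal K R" and B: "B \<subseteq> carrier R"
  shows "k_ideal (ideal_quotient R K B) R"
  unfolding k_ideal_iff
proof (intro conjI ballI impI)
  show "\<zero> \<in> ideal_quotient R K B"
    using B k_ideal_zero[OF K] by (auto simp: ideal_quotient_def)
next
  fix x y assume "x \<in> ideal_quotient R K B" "y \<in> ideal_quotient R K B"
  then show "x \<oplus> y \<in> ideal_quotient R K B"
    using B k_ideal_add[OF K] by (auto simp: ideal_quotient_def l_distr subset_iff)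
next
  fix r x assume "r \<in> carrier R" "x \<in> ideal_quotient R K B"
  then show "r \<otimes> x \<in> ideal_quotient R K B"
    using B k_ideal_mult[OF K] by (auto simp: ideal_quotient_def m_assoc subset_iff)
next
  fix x y assume *: "x \<in> ideal_quotient R K B" "y \<in> carrier R" "x \<oplus> y \<in> ideal_quotient R K B"
  have "y \<otimes> b \<in> K" if "b \<in> B" for b
  proof (rule k_ideal_cancel[OF K])
    show "x \<otimes> b \<in> K" "y \<otimes> b \<in> carrier R"
      using * that B by (auto simp: ideal_quotient_def)
    show "x \<otimes> b \<oplus> y \<otimes> b \<in> K"
      using * that B l_distr[of x y b] by (auto simp: ideal_quotient_def subset_iff)
  qed
  then show "y \<in> ideal_quotient R K B"
    using * by (auto simp: ideal_quotient_def)
qed (auto simp: ideal_quotient_def)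

text \<open>A bilinear extension in two passes. The quotient of \<open>K\<close> by \<open>X\<close>
  is a k-ideal containing \<open>Y\<close>, hence the span of \<open>Y\<close>; the quotient of
  \<open>K\<close> by that span is then a k-ideal containing \<open>X\<close>, hence the span of
  \<open>X\<close>. The factors are swapped in between because elements of a quotient stand on the
  left.\<close>

lemma k_span_mult:
  assumes K: "k_ideal K R" and X: "X \<subseteq> carrier R" and Y: "Y \<subseteq> carrier R"
    and prod: "\<And>x y. x \<in> X \<Longrightarrow> y \<in> Y \<Longrightarrow> x \<otimes> y \<in> K"
    and xy: "x \<in> k_span R X" "y \<in> k_span R Y"
  shows "x \<otimes> y \<in> K"
proof -
  have sub: "k_span R Y \<subseteq> carrier R"
    using k_ideal_subset k_ideal_k_span[OF Y] by blast
  have "y \<otimes> x \<in> K" if "x \<in> X" "y \<in> Y" for x y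
    using X Y prod[OF that] m_comm[of x y] that by (simp add: subset_iff)
  then have "Y \<subseteq> ideal_quotient R K X"
    using Y by (auto simp: ideal_quotient_def)
  then have "k_span R Y \<subseteq> ideal_quotient R K X"
    using k_span_least[OF k_ideal_ideal_quotient[OF K X]] by blast
  then have "y \<otimes> x \<in> K" if "x \<in> X" "y \<in> k_span R Y" for x y
    using that by (auto simp: ideal_quotient_def)
  then have "x \<otimes> y \<in> K" if "x \<in> X" "y \<in> k_span R Y" for x y
    using X sub m_comm[of x y] that by (simp add: subset_iff)
  then have "X \<subseteq> ideal_quotient R K (k_span R Y)"
    using X by (auto simp: ideal_quotient_def)
  then have "k_span R X \<subseteq> ideal_quotient R K (k_span R Y)"
    using k_span_least[OF k_ideal_ideal_quotient[OF K sub]] by blast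
  then show ?thesis
    using xy by (auto simp: ideal_quotient_def)
qed

text \<open>The universal property of the product, which is the least k-ideal containing all
  products \<open>x \<otimes> y\<close>.\<close>

lemma k_product_subset_iff:
  assumes "I \<subseteq> carrier R" and "J \<subseteq> carrier R" and K: "k_ideal K R"
  shows "k_product R I J \<subseteq> K \<longleftrightarrow> (\<forall>x\<in>I. \<forall>y\<in>J. x \<otimes> y \<in> K)"
proof -
  let ?X = "{x \<otimes> y |x y. x \<in> I \<and> y \<in> J}"
  have "?X \<subseteq> carrier R"
    using assms by auto
  then have "k_span R ?X \<subseteq> K \<longleftrightarrow> ?X \<subseteq> K"
    using k_span_superset[of ?X] k_span_least[OF K, of ?X] by (meson subset_trans)
  then show ?thesis
    unfolding k_product_def by blast
qed

lemma k_ideal_k_product: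
  "I \<subseteq> carrier R \<Longrightarrow> J \<subseteq> carrier R \<Longrightarrow> k_ideal (k_product R I J) R"
  unfolding k_product_def by (rule k_ideal_k_span) auto

lemma mult_in_k_product:
  "I \<subseteq> carrier R \<Longrightarrow> J \<subseteq> carrier R \<Longrightarrow> x \<in> I \<Longrightarrow> y \<in> J \<Longrightarrow> x \<otimes> y \<in> k_product R I J"
  using k_product_subset_iff[of I J "k_product R I J"] k_ideal_k_product[of I J] by simp

section \<open>k-prime ideals and the k-radical\<close>

text \<open>From ideals to elements, primality is applied to the principal k-ideals of
  \<open>a\<close> and \<open>b\<close>, whose product lies in \<open>P\<close> by
  \<open>k_span_mult\<close>. Conversely, elements of \<open>I\<close> and \<open>J\<close> outside
  \<open>P\<close> would have their product in \<open>P\<close>.\<close>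

lemma k_prime_ideal_iff:
  "k_prime_ideal P R \<longleftrightarrow> k_proper_ideal P R \<and>
    (\<forall>a\<in>carrier R. \<forall>b\<in>carrier R. a \<otimes> b \<in> P \<longrightarrow> a \<in> P \<or> b \<in> P)"
proof (intro iffI conjI ballI impI)
  fix a b assume P: "k_prime_ideal P R" and ab: "a \<in> carrier R" "b \<in> carrier R" "a \<otimes> b \<in> P"
  then have K: "k_ideal P R"
    by (simp add: k_prime_ideal_def k_proper_ideal_def)
  have k: "k_ideal (k_span R {a}) R" "k_ideal (k_span R {b}) R"
    using ab by (simp_all add: k_ideal_k_span)
  have "x \<otimes> y \<in> P" if "x \<in> k_span R {a}" "y \<in> k_span R {b}" for x y
    using k_span_mult[OF K _ _ _ that] ab by simp
  then have "k_product R (k_span R {a}) (k_span R {b}) \<subseteq> P"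
    using k_product_subset_iff[OF k[THEN k_ideal_subset] K] by blast
  then have "k_span R {a} \<subseteq> P \<or> k_span R {b} \<subseteq> P"
    using P k unfolding k_prime_ideal_def by blast
  then show "a \<in> P \<or> b \<in> P"
    using ab k_span_superset[of "{a}"] k_span_superset[of "{b}"] by auto
next
  assume P: "k_proper_ideal P R \<and>
    (\<forall>a\<in>carrier R. \<forall>b\<in>carrier R. a \<otimes> b \<in> P \<longrightarrow> a \<in> P \<or> b \<in> P)"
  have "I \<subseteq> P \<or> J \<subseteq> P" if IJ: "k_ideal I R" "k_ideal J R" "k_product R I J \<subseteq> P" for I J
    using P IJ(3) k_ideal_subset[OF IJ(1)] k_ideal_subset[OF IJ(2)] mult_in_k_product by blast
  then show "k_prime_ideal P R"
    using P by (simp add: k_prime_ideal_def)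
qed (simp add: k_prime_ideal_def)

lemma k_prime_ideal_pow:
  assumes P: "k_prime_ideal P R" and x: "x \<in> carrier R" "x [^] (n::nat) \<in> P"
  shows "x \<in> P"
  using x(2)
proof (induction n)
  case 0
  \<comment> \<open>For exponent zero the hypothesis reads \<open>\<one> \<in> P\<close>, which
    would make \<open>P\<close> the whole carrier.\<close>
  have "k_ideal P R" "P \<noteq> carrier R"
    using P by (simp_all add: k_prime_ideal_def k_proper_ideal_def)
  moreover have "\<one> \<in> P"
    using 0 by simp
  ultimately show ?case
    using k_ideal_subset k_ideal_mult[of P R _ \<one>] by (metis r_one subsetI subset_antisym)
next
  case (Suc n)
  then show ?case
    using P x(1) unfolding k_prime_ideal_iff by auto
qed

lemma exists_k_prime_ideal_avoiding_powers:
  assumes I: "k_ideal I R" and x: "x \<in> carrier R" and nI: "\<And>n::nat. x [^] n \<notin> I"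
  obtains P where "k_prime_ideal P R" "I \<subseteq> P" "x \<notin> P"
proof -
  let ?A = "{K. k_ideal K R \<and> I \<subseteq> K \<and> (\<forall>n::nat. x [^] n \<notin> K)}"
  \<comment> \<open>Zorn's lemma applies: \<open>I\<close> belongs to \<open>?A\<close>, and the
    union of a nonempty chain in \<open>?A\<close> still contains \<open>I\<close> and no power of
    \<open>x\<close>.\<close>
  have "\<exists>P\<in>?A. \<forall>K\<in>?A. P \<subseteq> K \<longrightarrow> K = P"
  proof (rule subset_Zorn_nonempty)
    show "?A \<noteq> {}"
      using I nI by blast
  next
    fix C assume C: "C \<noteq> {}" "subset.chain ?A C"
    then have "k_ideal (\<Union>C) R"
      by (intro k_ideal_Union_chain) (auto simp: subset.chain_def)
    then show "\<Union>C \<in> ?A"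
      using C by (auto simp: subset.chain_def)
  qed
  then obtain P where "P \<in> ?A" and P_max: "\<forall>K\<in>?A. P \<subseteq> K \<longrightarrow> K = P"
    by (rule bexE)
  then have P: "k_ideal P R" "I \<subseteq> P" "\<And>n::nat. x [^] n \<notin> P"
    by auto
  have max: "K = P" if "k_ideal K R" "P \<subseteq> K" "\<And>n::nat. x [^] n \<notin> K" for K
    using that P(2) by (intro P_max[rule_format]) auto
  have quot: "\<exists>n::nat. x [^] n \<otimes> b \<in> P"
    if "a \<in> carrier R" "b \<in> carrier R" "a \<otimes> b \<in> P" "a \<notin> P" for a b
  proof (rule ccontr)
    assume "\<not> ?thesis"
    then have "x [^] n \<notin> ideal_quotient R P {b}" for n :: nat
      by (simp add: ideal_quotient_def)
    moreover have "k_ideal (ideal_quotient R P {b}) R"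
      using that P by (simp add: k_ideal_ideal_quotient)
    moreover have "P \<subseteq> ideal_quotient R P {b}"
      using that k_ideal_mult_right[OF P(1)] k_ideal_subset[OF P(1)] by (auto simp: ideal_quotient_def)
    ultimately have "ideal_quotient R P {b} = P"
      by (intro max)
    then show False
      using that by (auto simp: ideal_quotient_def)
  qed
  have "a \<in> P \<or> b \<in> P" if ab: "a \<in> carrier R" "b \<in> carrier R" "a \<otimes> b \<in> P" for a b
  proof (rule ccontr)
    assume n: "\<not> (a \<in> P \<or> b \<in> P)"
    obtain n :: nat where "x [^] n \<otimes> b \<in> P"
      using quot ab n by blast
    then have "b \<otimes> x [^] n \<in> P"
      using ab x by (simp add: m_comm)
    then obtain m :: nat where "x [^] m \<otimes> x [^] n \<in> P"
      using quot[of b "x [^] n"] ab x n by auto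
    then show False
      using P(3)[of "m + n"] x by (simp add: nat_pow_mult)
  qed
  \<comment> \<open>The zeroth power of \<open>x\<close> is \<open>\<one>\<close>, so avoiding all
    powers makes \<open>P\<close> proper; the first power gives \<open>x \<notin> P\<close>.\<close>
  moreover have "P \<noteq> carrier R"
    using P(3)[of 0] by auto
  ultimately have "k_prime_ideal P R"
    unfolding k_prime_ideal_iff k_proper_ideal_def using P(1) by blast
  moreover have "x \<notin> P"
    using P(3)[of 1] x by simp
  ultimately show thesis
    using that P(2) by blast
qed

text \<open>This replaces the quantification over k-primes by a condition on powers, which a
  homomorphism transports. The exponent zero occurs only when \<open>I\<close> is the whole carrier,
  where both sides are the carrier.\<close>

lemma k_radical_eq:
  assumes "k_ideal I R"
  shows "k_radical R I = {x \<in> carrier R. \<exists>n::nat. x [^] n \<in> I}"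
proof (intro subset_antisym subsetI)
  fix x assume "x \<in> k_radical R I"
  then show "x \<in> {x \<in> carrier R. \<exists>n::nat. x [^] n \<in> I}"
    unfolding k_radical_def using exists_k_prime_ideal_avoiding_powers[OF assms] by blast
next
  fix x assume "x \<in> {x \<in> carrier R. \<exists>n::nat. x [^] n \<in> I}"
  then show "x \<in> k_radical R I"
    unfolding k_radical_def using k_prime_ideal_pow by blast
qed

text \<open>An intersection of k-ideals, with the carrier among them.\<close>

lemma k_ideal_k_radical: "k_ideal (k_radical R I) R"
proof -
  have carrier: "k_ideal (carrier R) R"
    by (simp add: k_ideal_iff)
  have "k_ideal P R" if "k_prime_ideal P R" for P
    using that by (simp add: k_prime_ideal_def k_proper_ideal_def)
  then show ?thesis
    using carrier unfolding k_radical_def k_ideal_iff[of "carrier R \<inter> _"]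
    by (auto intro: k_ideal_zero k_ideal_add k_ideal_mult k_ideal_cancel)
qed

text \<open>The kernel of a homomorphism is the contraction of this k-ideal.\<close>

lemma k_ideal_zero_set: "k_ideal {\<zero>} R"
  unfolding k_ideal_iff by auto

end

section \<open>Extension and contraction along a homomorphism\<close>

locale comm_semiring_hom =
  R: comm_semiring_struct R + S: comm_semiring_struct S
  for R (structure) and S (structure) +
  fixes h
  assumes hom: "h \<in> semiring_hom R S"
begin

lemma hom_closed [simp]: "x \<in> carrier R \<Longrightarrow> h x \<in> carrier S"
  and hom_add [simp]: "x \<in> carrier R \<Longrightarrow> y \<in> carrier R \<Longrightarrow> h (x \<oplus> y) = h x \<oplus>\<^bsub>S\<^esub> h y"
  and hom_mult [simp]: "x \<in> carrier R \<Longrightarrow> y \<in> carrier R \<Longrightarrow> h (x \<otimes> y) = h x \<otimes>\<^bsub>S\<^esub> h y"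
  and hom_one [simp]: "h \<one> = \<one>\<^bsub>S\<^esub>"
  and hom_zero [simp]: "h \<zero> = \<zero>\<^bsub>S\<^esub>"
  using hom unfolding semiring_hom_def
  by (auto simp: ring_hom_closed ring_hom_add ring_hom_mult ring_hom_one)

lemma hom_pow [simp]: "x \<in> carrier R \<Longrightarrow> h (x [^] (n::nat)) = h x [^]\<^bsub>S\<^esub> n"
  by (induction n) auto

abbreviation "ext \<equiv> k_extension S h"
abbreviation "con \<equiv> k_contraction R h"

lemma k_ideal_con: "k_ideal J S \<Longrightarrow> k_ideal (con J) R"
  unfolding k_contraction_def k_ideal_iff[of _ R]
  by (auto intro: k_ideal_zero k_ideal_add k_ideal_mult k_ideal_cancel)

lemma k_ideal_ext: "I \<subseteq> carrier R \<Longrightarrow> k_ideal (ext I) S"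
  unfolding k_extension_def by (rule S.k_ideal_k_span) auto

lemma hom_in_ext: "I \<subseteq> carrier R \<Longrightarrow> x \<in> I \<Longrightarrow> h x \<in> ext I"
  unfolding k_extension_def by (rule subsetD[OF S.k_span_superset]) auto

text \<open>The Galois connection between extension and contraction: since \<open>ext I\<close> is
  the least k-ideal containing the image of \<open>I\<close>, both sides say that this image lies in
  \<open>K\<close>. The composites of \<open>ext\<close> and \<open>con\<close> are then handled
  formally.\<close>

lemma ext_subset_iff:
  assumes "I \<subseteq> carrier R" and "k_ideal K S"
  shows "ext I \<subseteq> K \<longleftrightarrow> I \<subseteq> con K"
proof
  assume "ext I \<subseteq> K"
  then show "I \<subseteq> con K"
    using assms hom_in_ext unfolding k_contraction_def by blast
next
  assume "I \<subseteq> con K"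
  then show "ext I \<subseteq> K"
    unfolding k_extension_def k_contraction_def by (intro S.k_span_least assms) auto
qed

lemma con_subset_carrier: "con J \<subseteq> carrier R"
  by (auto simp: k_contraction_def)

lemma con_mono: "J \<subseteq> K \<Longrightarrow> con J \<subseteq> con K"
  by (auto simp: k_contraction_def)

lemma subset_con_ext: "I \<subseteq> carrier R \<Longrightarrow> I \<subseteq> con (ext I)"
  using ext_subset_iff k_ideal_ext by blast

lemma ext_con_subset: "k_ideal J S \<Longrightarrow> ext (con J) \<subseteq> J"
  using ext_subset_iff con_subset_carrier by blast

lemma ext_mono: "I \<subseteq> K \<Longrightarrow> K \<subseteq> carrier R \<Longrightarrow> ext I \<subseteq> ext K"
  by (metis ext_subset_iff k_ideal_ext subset_con_ext subset_trans)

lemma con_ext_con: "k_ideal J S \<Longrightarrow> con (ext (con J)) = con J"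
  by (simp add: con_mono con_subset_carrier ext_con_subset subset_antisym subset_con_ext)

lemma ext_con_ext: "I \<subseteq> carrier R \<Longrightarrow> ext (con (ext I)) = ext I"
  by (simp add: con_subset_carrier ext_con_subset ext_mono k_ideal_ext subset_antisym subset_con_ext)

text \<open>On these fixed points \<open>ext\<close> and \<open>con\<close> are mutually inverse by
  definition; it remains that both maps preserve k-ideals.\<close>

lemma bij_betw_ext:
  "bij_betw ext {A. k_ideal A R \<and> con (ext A) = A} {B. k_ideal B S \<and> ext (con B) = B}"
  by (rule bij_betw_byWitness[where f' = con])
    (auto simp: k_ideal_con k_ideal_ext k_ideal_subset)

text \<open>One inclusion passes through \<open>ext_subset_iff\<close> to products of elements of
  \<open>I\<close> and \<open>J\<close>. For the other, products of images lie in the extension by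
  multiplicativity of \<open>h\<close>, and \<open>k_span_mult\<close> carries this from the images
  to their spans.\<close>

lemma ext_k_product:
  assumes I: "I \<subseteq> carrier R" and J: "J \<subseteq> carrier R"
  shows "ext (k_product R I J) = k_product S (ext I) (ext J)"
proof
  have sub: "ext I \<subseteq> carrier S" "ext J \<subseteq> carrier S" "k_product R I J \<subseteq> carrier R"
    using k_ideal_ext[OF I] k_ideal_ext[OF J] R.k_ideal_k_product[OF I J]
    by (simp_all add: k_ideal_subset)
  have K: "k_ideal (k_product S (ext I) (ext J)) S"
    using sub by (simp add: S.k_ideal_k_product)
  have "x \<otimes> y \<in> con (k_product S (ext I) (ext J))" if "x \<in> I" "y \<in> J" for x y
    using that assms sub by (auto simp: k_contraction_def subset_iff S.mult_in_k_product hom_in_ext)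
  then show "ext (k_product R I J) \<subseteq> k_product S (ext I) (ext J)"
    by (simp add: ext_subset_iff sub K R.k_product_subset_iff I J k_ideal_con)
  have L: "k_ideal (ext (k_product R I J)) S"
    using sub by (simp add: k_ideal_ext)
  have prod: "x \<otimes>\<^bsub>S\<^esub> y \<in> ext (k_product R I J)" if "x \<in> h ` I" "y \<in> h ` J" for x y
  proof -
    obtain a b where ab: "a \<in> I" "b \<in> J" "x = h a" "y = h b"
      using \<open>x \<in> h ` I\<close> \<open>y \<in> h ` J\<close> by blast
    then have "x \<otimes>\<^bsub>S\<^esub> y = h (a \<otimes> b)"
      using I J by (simp add: subset_iff)
    then show ?thesis
      using ab hom_in_ext[OF sub(3)] R.mult_in_k_product[OF I J] by auto
  qed
  have "x \<otimes>\<^bsub>S\<^esub> y \<in> ext (k_product R I J)" if "x \<in> ext I" "y \<in> ext J" for x y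
    using that I J unfolding k_extension_def[of S h I] k_extension_def[of S h J]
    by (intro S.k_span_mult[OF L _ _ prod]) auto
  then show "k_product S (ext I) (ext J) \<subseteq> ext (k_product R I J)"
    by (simp add: S.k_product_subset_iff sub L)
qed

lemma ext_ideal_quotient_subset:
  assumes I: "I \<subseteq> carrier R" and J: "J \<subseteq> carrier R"
  shows "ext (ideal_quotient R I J) \<subseteq> ideal_quotient S (ext I) (ext J)"
proof -
  have sub: "ext J \<subseteq> carrier S"
    using J k_ideal_ext k_ideal_subset by blast
  have "h r \<in> ideal_quotient S (ext I) (ext J)" if r: "r \<in> ideal_quotient R I J" for r
  proof -
    have rc: "r \<in> carrier R" "\<And>x. x \<in> J \<Longrightarrow> r \<otimes> x \<in> I"
      using r by (auto simp: ideal_quotient_def)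
    \<comment> \<open>With \<open>r\<close> fixed, the elements that multiply \<open>h r\<close>
      into \<open>ext I\<close> form a k-ideal. It contains the image of \<open>J\<close>, hence all
      of \<open>ext J\<close>.\<close>
    have K: "k_ideal (ideal_quotient S (ext I) {h r}) S"
      using I rc by (simp add: S.k_ideal_ideal_quotient k_ideal_ext)
    have "x \<in> con (ideal_quotient S (ext I) {h r})" if x: "x \<in> J" for x
    proof -
      have "h x \<otimes>\<^bsub>S\<^esub> h r = h (r \<otimes> x)"
        using x J rc by (auto simp: S.m_comm subset_iff)
      then show ?thesis
        using x J rc hom_in_ext[OF I] by (auto simp: ideal_quotient_def k_contraction_def)
    qed
    then have "ext J \<subseteq> ideal_quotient S (ext I) {h r}"
      using ext_subset_iff[OF J K] by blast
    then show ?thesis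
      using rc sub by (auto simp: ideal_quotient_def S.m_comm subset_iff)
  qed
  then have "ideal_quotient R I J \<subseteq> con (ideal_quotient S (ext I) (ext J))"
    by (auto simp: k_contraction_def ideal_quotient_def)
  moreover have "k_ideal (ideal_quotient S (ext I) (ext J)) S"
    using I sub by (simp add: S.k_ideal_ideal_quotient k_ideal_ext)
  ultimately show ?thesis
    by (subst ext_subset_iff) (auto simp: ideal_quotient_def)
qed

lemma k_product_con_subset:
  assumes "J \<subseteq> carrier S" and "K \<subseteq> carrier S"
  shows "k_product R (con J) (con K) \<subseteq> con (k_product S J K)"
proof -
  have "x \<otimes> y \<in> con (k_product S J K)" if "x \<in> con J" "y \<in> con K" for x y
    using that S.mult_in_k_product[OF assms] by (auto simp: k_contraction_def)
  then show ?thesis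
    using assms by (simp add: R.k_product_subset_iff con_subset_carrier k_ideal_con S.k_ideal_k_product)
qed

lemma con_ideal_quotient_subset:
  "con (ideal_quotient S J K) \<subseteq> ideal_quotient R (con J) (con K)"
  by (auto simp: k_contraction_def ideal_quotient_def)

text \<open>By \<open>k_radical_eq\<close> both sides are conditions on powers, and they agree
  because \<open>h\<close> sends \<open>x [^] n\<close> to the \<open>n\<close>-th power of
  \<open>h x\<close>.\<close>

lemma con_k_radical: "k_ideal J S \<Longrightarrow> con (k_radical S J) = k_radical R (con J)"
  by (simp add: R.k_radical_eq S.k_radical_eq k_ideal_con) (auto simp: k_contraction_def)

text \<open>By the Galois connection it suffices to work in \<open>R\<close>, where
  \<open>I \<subseteq> con (ext I)\<close>, monotonicity of the radical and
  \<open>con_k_radical\<close> finish.\<close>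

lemma ext_k_radical_subset:
  assumes I: "k_ideal I R"
  shows "ext (k_radical R I) \<subseteq> k_radical S (ext I)"
proof -
  have sub: "I \<subseteq> carrier R" "k_radical R I \<subseteq> carrier R"
    using I k_ideal_subset by (auto simp: k_radical_def)
  have "k_radical R I \<subseteq> k_radical R (con (ext I))"
    using subset_con_ext[OF sub(1)] by (auto simp: k_radical_def)
  then have "k_radical R I \<subseteq> con (k_radical S (ext I))"
    by (simp add: con_k_radical k_ideal_ext sub)
  then show ?thesis
    by (simp add: ext_subset_iff sub S.k_ideal_k_radical)
qed

end

theorem theorem4p2:
  fixes R :: "('a, 'm) ring_scheme" and R' :: "('b, 'n) ring_scheme"
    and \<phi> :: "'a \<Rightarrow> 'b"
    and I I\<^sub>1 I\<^sub>2 :: "'a set" and J J\<^sub>1 J\<^sub>2 :: "'b set"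
    and ext :: "'a set \<Rightarrow> 'b set" and con :: "'b set \<Rightarrow> 'a set"
  defines "ext \<equiv> k_extension R' \<phi>" and "con \<equiv> k_contraction R \<phi>"
  assumes "comm_semiring_struct R" and "comm_semiring_struct R'"
    and "\<phi> \<in> semiring_hom R R'"
    and "k_ideal I R" and "k_ideal I\<^sub>1 R" and "k_ideal I\<^sub>2 R"
    and "k_ideal J R'" and "k_ideal J\<^sub>1 R'" and "k_ideal J\<^sub>2 R'"
  shows
    "k_ideal (con J) R \<and>
     k_ideal {r \<in> carrier R. \<phi> r = \<zero>\<^bsub>R'\<^esub>} R \<and>
     k_ideal (ext I) R' \<and>
     (I \<subseteq> con (ext I) \<and>
      J \<supseteq> ext (con J) \<and>
      con J = con (ext (con J)) \<and>
      ext I = ext (con (ext I))) \<and>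
     (\<exists>f. bij_betw f {A. k_ideal A R \<and> con (ext A) = A} {B. k_ideal B R' \<and> ext (con B) = B}) \<and>
     (ext (I\<^sub>1 \<inter> I\<^sub>2) \<subseteq> ext I\<^sub>1 \<inter> ext I\<^sub>2 \<and>
      ext (k_product R I\<^sub>1 I\<^sub>2) = k_product R' (ext I\<^sub>1) (ext I\<^sub>2) \<and>
      ext (ideal_quotient R I\<^sub>1 I\<^sub>2) \<subseteq> ideal_quotient R' (ext I\<^sub>1) (ext I\<^sub>2) \<and>
      ext (k_radical R I) \<subseteq> k_radical R' (ext I)) \<and>
     (con (J\<^sub>1 \<inter> J\<^sub>2) = con J\<^sub>1 \<inter> con J\<^sub>2 \<and>
      con (k_product R' J\<^sub>1 J\<^sub>2) \<supseteq> k_product R (con J\<^sub>1) (con J\<^sub>2) \<and>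
      con (ideal_quotient R' J\<^sub>1 J\<^sub>2) \<subseteq> ideal_quotient R (con J\<^sub>1) (con J\<^sub>2) \<and>
      con (k_radical R' J) = k_radical R (con J)) \<and>
     con (k_radical R' J) \<subseteq> k_radical R (con J)"
proof -
  interpret comm_semiring_hom R R' \<phi>
    using assms(3-5) by (simp add: comm_semiring_hom_def comm_semiring_hom_axioms_def)
  note k = assms(6-11)
  note sub = k[THEN k_ideal_subset]
  have "k_ideal {r \<in> carrier R. \<phi> r = \<zero>\<^bsub>R'\<^esub>} R"
    using k_ideal_con[OF S.k_ideal_zero_set] by (simp add: k_contraction_def)
  moreover have "k_extension R' \<phi> (I\<^sub>1 \<inter> I\<^sub>2) \<subseteq> k_extension R' \<phi> I\<^sub>1 \<inter> k_extension R' \<phi> I\<^sub>2"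
    using sub by (simp add: ext_mono)
  moreover have
    "k_contraction R \<phi> (J\<^sub>1 \<inter> J\<^sub>2) = k_contraction R \<phi> J\<^sub>1 \<inter> k_contraction R \<phi> J\<^sub>2"
    by (auto simp: k_contraction_def)
  \<comment> \<open>The bijection is extension itself, and the final inclusion is one half of the
    equality \<open>con_k_radical\<close>.\<close>
  ultimately show ?thesis
    unfolding ext_def con_def
    using k sub bij_betw_ext
    by (intro conjI exI[of _ "k_extension R' \<phi>"])
      (simp_all add: k_ideal_con k_ideal_ext subset_con_ext ext_con_subset con_ext_con ext_con_ext
        ext_k_product ext_ideal_quotient_subset ext_k_radical_subset k_product_con_subset
        con_ideal_quotient_subset con_k_radical)
qed

end
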